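(* Let $X$, $Y$, $(\mathcal{L},\tau)$, $M(X,\mathcal{L})$ and $M_0(X,\mathcal{L})$ be as in the context, and suppose that Assumption (A) stated there holds. Then for every $x\in M(X,\mathcal{L})$ it holds that $$\operatorname{dist}(x,M_0(X,\mathcal{L}))_{M(X,\mathcal{L})}=\min_{x_0\in M_0(X,\mathcal{L})}\|x-x_0\|_M=\varlimsup_{\mathcal{L}\ni L\to\infty}\|Lx\|_Y ;$$ in particular the minimum is attained.
   Context: Setting. $X$ and $Y$ are Banach spaces, with $X$ separable and reflexive. $\mathcal{L}\subset B(X,Y)$ is a collection of bounded linear operators $L:X\to Y$, equipped with a topology $\tau$ such that $(\mathcal{L},\tau)$ is Hausdorff, $\sigma$-compact and locally compact, and such that for every $x\in X$ the map $L\mapsto Lx$ is continuous from $(\mathcal{L},\tau)$ to $Y$. The limit $L\to\infty$ means that $L$ escapes all compact subsets of $(\mathcal{L},\tau)$ (equivalently, $L$ tends to $\infty$ in the one-point compactification $\mathcal{L}\cup\{\infty\}$); thus $\varlimsup_{\mathcal{L}\ni L\to\infty}\|Lx\|_Y=\inf_{K}\sup_{L\in\mathcal{L}\setminus K}\|Lx\|_Y$, the infimum being over compact $K\subset\mathcal{L}$, with $\sup\emptyset=0$. Define $$M(X,\mathcal{L})=\{x\in X:\sup_{L\in\mathcal{L}}\|Lx\|_Y<\infty\},\qquad M_0(X,\mathcal{L})=\{x\in M(X,\mathcal{L}):\varlimsup_{\mathcal{L}\ni L\to\infty}\|Lx\|_Y=0\},$$ with norm $\|x\|_M=\sup_{L\in\mathcal{L}}\|Lx\|_Y$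 on both. It is assumed that $M(X,\mathcal{L})$ is dense in $X$ in the $X$-norm, and that $M(X,\mathcal{L})$ is a Banach space under $\|\cdot\|_M$, continuously contained in $X$. Assumption (A). For every $x\in M(X,\mathcal{L})$ there is a bounded sequence $(x_n)_{n=1}^\infty$ in $M_0(X,\mathcal{L})$ such that $x_n$ converges weakly to $x$ in $X$ and $\sup_n\|x_n\|_M\le\|x\|_M$. The distance is $\operatorname{dist}(x,M_0(X,\mathcal{L}))_{M(X,\mathcal{L})}=\inf_{x_0\in M_0(X,\mathcal{L})}\|x-x_0\|_M$. *)

theory Defs
  imports "HOL-Analysis.Analysis"
begin

text \<open>
  Banach spaces are taken over the reals. This includes the complex case: restricting the scalars
  of a complex Banach space to the reals preserves norms, boundedness of operators, separability,
  reflexivity and weak convergence (every real functional is the real part of a complex one).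
\<close>

lift_definition bidual_embedding ::
    "'a::real_normed_vector \<Rightarrow> (('a \<Rightarrow>\<^sub>L real) \<Rightarrow>\<^sub>L real)"
  is "\<lambda>x f. blinfun_apply f x"
  by (rule blinfun.bounded_linear_left)

definition reflexive_space :: "'a::real_normed_vector itself \<Rightarrow> bool" where
  "reflexive_space _ \<longleftrightarrow> surj (bidual_embedding :: 'a \<Rightarrow> (('a \<Rightarrow>\<^sub>L real) \<Rightarrow>\<^sub>L real))"

definition weakly_converges_to :: "(nat \<Rightarrow> 'a::real_normed_vector) \<Rightarrow> 'a \<Rightarrow> bool" where
  "weakly_converges_to u x \<longleftrightarrow>
     (\<forall>f :: 'a \<Rightarrow>\<^sub>L real. (\<lambda>n. blinfun_apply f (u n)) \<longlonglongrightarrow> blinfun_apply f x)"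

definition sigma_compact_space :: "'a topology \<Rightarrow> bool" where
  "sigma_compact_space T \<longleftrightarrow>
     (\<exists>K :: nat \<Rightarrow> 'a set. (\<forall>n. compactin T (K n)) \<and> (\<Union>n. K n) = topspace T)"

definition banach_under :: "'a::real_vector set \<Rightarrow> ('a \<Rightarrow> real) \<Rightarrow> bool" where
  "banach_under V N \<longleftrightarrow>
     subspace V \<and>
     (\<forall>x\<in>V. 0 \<le> N x \<and> (N x = 0 \<longleftrightarrow> x = 0)) \<and>
     (\<forall>c. \<forall>x\<in>V. N (c *\<^sub>R x) = \<bar>c\<bar> * N x) \<and>
     (\<forall>x\<in>V. \<forall>y\<in>V. N (x + y) \<le> N x + N y) \<and>
     (\<forall>u :: nat \<Rightarrow> 'a. (\<forall>n. u n \<in> V) \<and> (\<forall>e>0. \<exists>n0. \<forall>m\<ge>n0. \<forall>n\<ge>n0. N (u m - u n) < e)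
        \<longrightarrow> (\<exists>x\<in>V. (\<lambda>n. N (u n - x)) \<longlonglongrightarrow> 0))"

text \<open>
  Inserting \<open>0\<close> implements the convention that the supremum of the empty set is \<open>0\<close>. It changes
  nothing for a nonempty set, because all suprema are of norms.
\<close>

definition sup_op_norm ::
    "('a::real_normed_vector \<Rightarrow>\<^sub>L 'b::real_normed_vector) set \<Rightarrow> 'a \<Rightarrow> real" where
  "sup_op_norm S x = Sup (insert 0 ((\<lambda>L. norm (blinfun_apply L x)) ` S))"

definition M_space ::
    "('a::real_normed_vector \<Rightarrow>\<^sub>L 'b::real_normed_vector) set \<Rightarrow> 'a set" where
  "M_space \<L> = {x. bdd_above ((\<lambda>L. norm (blinfun_apply L x)) ` \<L>)}"

abbreviation M_norm ::
    "('a::real_normed_vector \<Rightarrow>\<^sub>L 'b::real_normed_vector) set \<Rightarrow> 'a \<Rightarrow> real" where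
  "M_norm \<L> x \<equiv> sup_op_norm \<L> x"

text \<open>
  The upper limit of \<open>norm (L x)\<close> as \<open>L\<close> leaves all compact sets. It is real-valued, and hence
  meaningful for \<open>x \<in> M_space (topspace T)\<close> only, where all the suprema are finite.
\<close>

definition limsup_escaping ::
    "('a::real_normed_vector \<Rightarrow>\<^sub>L 'b::real_normed_vector) topology \<Rightarrow> 'a \<Rightarrow> real" where
  "limsup_escaping T x = (INF K\<in>{K. compactin T K}. sup_op_norm (topspace T - K) x)"

definition M0_space ::
    "('a::real_normed_vector \<Rightarrow>\<^sub>L 'b::real_normed_vector) topology \<Rightarrow> 'a set" where
  "M0_space T = {x \<in> M_space (topspace T). limsup_escaping T x = 0}"

definition M_dist ::
    "('a::real_normed_vector \<Rightarrow>\<^sub>L 'b::real_normed_vector) set \<Rightarrow> 'a \<Rightarrow> 'a set \<Rightarrow> real" where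
  "M_dist \<L> x A = (INF z\<in>A. M_norm \<L> (x - z))"

definition assumption_A ::
    "('a::real_normed_vector \<Rightarrow>\<^sub>L 'b::real_normed_vector) topology \<Rightarrow> bool" where
  "assumption_A T \<longleftrightarrow>
     (\<forall>x \<in> M_space (topspace T). \<exists>u :: nat \<Rightarrow> 'a.
        (\<forall>n. u n \<in> M0_space T) \<and>
        bdd_above (range (\<lambda>n. M_norm (topspace T) (u n))) \<and>
        weakly_converges_to u x \<and>
        (SUP n. M_norm (topspace T) (u n)) \<le> M_norm (topspace T) x)"

end

theory Submission
  imports Defs
begin

text \<open>
  The upper limit is unchanged by adding an element of \<open>M\<^sub>0\<close> and is bounded by the norm, so it is a
  lower bound for the distance. For the converse, Assumption (A), Mazur's lemma and the uniform
  boundedness principle give elements of \<open>M\<^sub>0\<close> of norm at most that of \<open>w\<close> on which the operators of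
  a given compact set take almost the same values as on \<open>w\<close>. Averaging many of these along growing
  compact sets yields a cutoff \<open>z\<close> of \<open>w\<close>: always \<open>L z\<close> is close to some multiple \<open>r L w\<close> with
  \<open>0 \<le> r \<le> 1\<close>, and \<open>r = 1\<close> on a prescribed compact set. If the norm of \<open>w\<close> exceeds the upper limit
  by at most \<open>e\<close>, subtracting a multiple of \<open>z\<close> of norm at most \<open>e\<close> makes the excess as small as
  desired. Iterating with \<open>e\<close> decreasing geometrically gives a Cauchy sequence, whose limit is a
  best approximation.
\<close>

section \<open>Hahn--Banach, Mazur and Banach--Steinhaus\<close>

text \<open>Functionals defined as infima are shown below to be subadditive by letting the two
  indices vary independently.\<close>

lemma le_cINF_add:
  fixes f :: "'a \<Rightarrow> real" and g :: "'b \<Rightarrow> real"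
  assumes "A \<noteq> {}" "B \<noteq> {}" and le: "\<And>a b. a \<in> A \<Longrightarrow> b \<in> B \<Longrightarrow> k \<le> f a + g b"
  shows "k \<le> (INF a\<in>A. f a) + (INF b\<in>B. g b)"
proof -
  have "k - (INF a\<in>A. f a) \<le> g b" if "b \<in> B" for b
  proof -
    have "k - g b \<le> (INF a\<in>A. f a)"
      using le[OF _ that] by (intro cINF_greatest \<open>A \<noteq> {}\<close>) (simp add: algebra_simps)
    then show ?thesis by simp
  qed
  then have "k - (INF a\<in>A. f a) \<le> (INF b\<in>B. g b)"
    by (intro cINF_greatest \<open>B \<noteq> {}\<close>)
  then show ?thesis by simp
qed

lemma le_cINF_mult:
  fixes f :: "'a \<Rightarrow> real"
  assumes "A \<noteq> {}" "c > 0" and le: "\<And>a. a \<in> A \<Longrightarrow> k \<le> c * f a"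
  shows "k \<le> c * (INF a\<in>A. f a)"
proof -
  have "k / c \<le> (INF a\<in>A. f a)"
    using le \<open>c > 0\<close> by (intro cINF_greatest \<open>A \<noteq> {}\<close>) (simp add: field_simps)
  then show ?thesis using \<open>c > 0\<close> by (simp add: field_simps)
qed

section \<open>The Hahn--Banach theorem through minimal sublinear functionals\<close>

definition sublinear :: "('a::real_vector \<Rightarrow> real) \<Rightarrow> bool" where
  "sublinear q \<longleftrightarrow> (\<forall>x y. q (x + y) \<le> q x + q y) \<and> (\<forall>c>0. \<forall>x. q (c *\<^sub>R x) \<le> c * q x)"

lemma sublinear_add: "sublinear q \<Longrightarrow> q (x + y) \<le> q x + q y"
  by (simp add: sublinear_def)

lemma sublinear_0:
  assumes "sublinear q"
  shows "q 0 = 0"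
proof -
  \<comment> \<open>The first inequality gives \<open>q 0 \<le> 0\<close>, the second
    \<open>q 0 \<ge> 0\<close>.\<close>
  have "q ((1/2) *\<^sub>R 0) \<le> 1/2 * q 0" "q (0 + 0) \<le> q 0 + q 0"
    using assms unfolding sublinear_def by (smt (verit) zero_less_divide_1_iff)+
  then show ?thesis by simp
qed

lemma sublinear_scaleR:
  assumes "sublinear q" "c \<ge> 0"
  shows "q (c *\<^sub>R x) = c * q x"
proof (cases "c = 0")
  case True
  then show ?thesis using sublinear_0[OF assms(1)] by simp
next
  case False
  then have "c > 0" using assms by simp
  have le: "q (c *\<^sub>R x) \<le> c * q x" if "c > 0" for c x
    using assms(1) that by (simp add: sublinear_def)
  have "q ((1/c) *\<^sub>R (c *\<^sub>R x)) \<le> 1/c * q (c *\<^sub>R x)"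
    using \<open>c > 0\<close> by (intro le) simp
  then have "c * q x \<le> q (c *\<^sub>R x)"
    using \<open>c > 0\<close> by (simp add: field_simps)
  then show ?thesis using le[OF \<open>c > 0\<close>, of x] by simp
qed

lemma sublinear_minus: "sublinear q \<Longrightarrow> - q (- x) \<le> q x"
  using sublinear_add[of q x "- x"] sublinear_0[of q] by simp

text \<open>A sublinear functional that is minimal in the pointwise order is linear, so no partially
  defined functionals are needed.\<close>

lemma ex_minimal_sublinear:
  assumes "sublinear p"
  obtains q where "sublinear q" "q \<le> p" "\<And>r. sublinear r \<Longrightarrow> r \<le> q \<Longrightarrow> r = q"
proof -
  define A where "A = {q. sublinear q \<and> q \<le> p}"
  have "\<exists>m\<in>A. \<forall>a\<in>A. a \<le> m \<longrightarrow> a = m"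
  \<comment> \<open>The order is reversed, so that the maximal element supplied by Zorn's lemma is a
    minimal functional and upper bounds of chains are pointwise infima.\<close>
  proof (rule predicate_Zorn[where P = "\<lambda>a b. b \<le> a"])
    show "partial_order_on A (relation_of (\<lambda>a b. b \<le> a) A)"
      by (rule partial_order_on_relation_ofI) auto
  next
    fix C
    assume C: "C \<in> Chains (relation_of (\<lambda>a b. b \<le> a) A)"
    then have CA: "C \<subseteq> A" and total: "\<And>a b. a \<in> C \<Longrightarrow> b \<in> C \<Longrightarrow> a \<le> b \<or> b \<le> a"
      by (auto simp: Chains_def relation_of_def)
    show "\<exists>u\<in>A. \<forall>a\<in>C. u \<le> a"
    proof (cases "C = {}")
      case True
      then show ?thesis using assms by (auto simp: A_def)
    next
      case False
      define u where "u = (\<lambda>x. INF q\<in>C. q x)"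
      \<comment> \<open>Each \<open>q\<close> in the chain satisfies
        \<open>q x \<ge> - q (- x) \<ge> - p (- x)\<close>, which makes the real infimum
        meaningful.\<close>
      have bdd: "bdd_below ((\<lambda>q. q x) ` C)" for x
      proof (rule bdd_belowI2)
        fix q assume "q \<in> C"
        then have "sublinear q" "q (- x) \<le> p (- x)"
          using CA by (auto simp: A_def le_fun_def)
        then show "- p (- x) \<le> q x" using sublinear_minus[of q x] by linarith
      qed
      have lower: "u x \<le> q x" if "q \<in> C" for q x
        unfolding u_def by (rule cINF_lower[OF bdd that])
      have "u (x + y) \<le> u x + u y" for x y
      proof -
        have "u (x + y) \<le> q1 x + q2 y" if q12: "q1 \<in> C" "q2 \<in> C" for q1 q2
        proof -
          \<comment> \<open>In a chain the smaller of \<open>q1\<close> and \<open>q2\<close> serves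
            both arguments at once.\<close>
          obtain q where q: "q \<in> C" "q \<le> q1" "q \<le> q2"
            using total[OF q12] q12 by blast
          then have "u (x + y) \<le> q (x + y)" using lower by blast
          also have "\<dots> \<le> q x + q y"
            using q CA by (auto simp: A_def sublinear_def)
          also have "\<dots> \<le> q1 x + q2 y"
            using q by (auto simp: le_fun_def intro: add_mono)
          finally show ?thesis .
        qed
        then show ?thesis
          using le_cINF_add[OF False False, of "u (x + y)" "\<lambda>q. q x" "\<lambda>q. q y"]
          by (simp add: u_def)
      qed
      moreover have "u (c *\<^sub>R x) \<le> c * u x" if "c > 0" for c x
      proof -
        have "u (c *\<^sub>R x) \<le> c * q x" if "q \<in> C" for q
        proof -
          have "u (c *\<^sub>R x) \<le> q (c *\<^sub>R x)" by (rule lower[OF that])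
          also have "\<dots> \<le> c * q x"
            using that CA \<open>c > 0\<close> by (auto simp: A_def sublinear_def)
          finally show ?thesis .
        qed
        then show ?thesis
          using le_cINF_mult[OF False \<open>c > 0\<close>, of "u (c *\<^sub>R x)" "\<lambda>q. q x"] by (simp add: u_def)
      qed
      ultimately have "sublinear u" by (simp add: sublinear_def)
      moreover have "u \<le> p"
      proof -
        obtain q where "q \<in> C" using False by blast
        then have "u \<le> q" "q \<le> p" using lower CA by (auto simp: A_def le_fun_def)
        then show ?thesis by (rule order_trans)
      qed
      ultimately show ?thesis using lower by (auto simp: A_def le_fun_def)
    qed
  qed
  then obtain q where "q \<in> A" "\<And>a. a \<in> A \<Longrightarrow> a \<le> q \<Longrightarrow> a = q" by blast
  moreover have "a \<in> A" if "sublinear a" "a \<le> q" for a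
    using that \<open>q \<in> A\<close> order_trans[of a q p] by (simp add: A_def)
  ultimately show ?thesis
    by (intro that[of q]) (auto simp: A_def)
qed

text \<open>Sliding the argument along \<open>y\<close> and paying \<open>t * q y\<close> for it
  gives a sublinear \<open>r\<close> below \<open>q\<close>. By minimality \<open>r = q\<close>, and
  \<open>t = 1\<close> yields the missing inequality
  \<open>q x + q y \<le> q (x + y)\<close>.\<close>

lemma minimal_sublinear_add:
  assumes q: "sublinear q" and minimal: "\<And>r. sublinear r \<Longrightarrow> r \<le> q \<Longrightarrow> r = q"
  shows "q (x + y) = q x + q y"
proof -
  define r where "r = (\<lambda>x. INF t\<in>{0..}. q (x + t *\<^sub>R y) - t * q y)"
  have bdd: "bdd_below ((\<lambda>t. q (x + t *\<^sub>R y) - t * q y) ` {0..})" for x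
  proof (rule bdd_belowI2)
    fix t :: real assume "t \<in> {0..}"
    then have "t * q y = q ((x + t *\<^sub>R y) + (- x))"
      using sublinear_scaleR[OF q, of t y] by simp
    also have "\<dots> \<le> q (x + t *\<^sub>R y) + q (- x)" by (rule sublinear_add[OF q])
    finally show "- q (- x) \<le> q (x + t *\<^sub>R y) - t * q y" by simp
  qed
  have lower: "r x \<le> q (x + t *\<^sub>R y) - t * q y" if "t \<ge> 0" for x t
    unfolding r_def using that by (intro cINF_lower bdd) simp
  have "r (v + w) \<le> r v + r w" for v w
  proof -
    have "r (v + w) \<le> (q (v + t *\<^sub>R y) - t * q y) + (q (w + s *\<^sub>R y) - s * q y)"
      if "t \<in> {0..}" "s \<in> {0..}" for t s
    proof -
      have "r (v + w) \<le> q ((v + w) + (t + s) *\<^sub>R y) - (t + s) * q y"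
        using that by (intro lower) simp
      also have "\<dots> = q ((v + t *\<^sub>R y) + (w + s *\<^sub>R y)) - (t + s) * q y"
        by (simp add: algebra_simps)
      also have "\<dots> \<le> (q (v + t *\<^sub>R y) + q (w + s *\<^sub>R y)) - (t + s) * q y"
        using sublinear_add[OF q] by simp
      finally show ?thesis by (simp add: algebra_simps)
    qed
    then have "r (v + w) \<le> (INF t\<in>{0..}. q (v + t *\<^sub>R y) - t * q y)
        + (INF t\<in>{0..}. q (w + t *\<^sub>R y) - t * q y)"
      by (intro le_cINF_add) auto
    then show ?thesis by (simp add: r_def)
  qed
  moreover have "r (c *\<^sub>R v) \<le> c * r v" if "c > 0" for c v
  proof -
    have "r (c *\<^sub>R v) \<le> c * (q (v + t *\<^sub>R y) - t * q y)" if "t \<in> {0..}" for t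
    proof -
      have "r (c *\<^sub>R v) \<le> q (c *\<^sub>R v + (c * t) *\<^sub>R y) - (c * t) * q y"
        using that \<open>c > 0\<close> by (intro lower) simp
      also have "\<dots> = q (c *\<^sub>R (v + t *\<^sub>R y)) - (c * t) * q y"
        by (simp add: algebra_simps)
      also have "\<dots> = c * (q (v + t *\<^sub>R y) - t * q y)"
        using sublinear_scaleR[OF q, of c "v + t *\<^sub>R y"] \<open>c > 0\<close> by (simp add: right_diff_distrib)
      finally show ?thesis .
    qed
    then have "r (c *\<^sub>R v) \<le> c * (INF t\<in>{0..}. q (v + t *\<^sub>R y) - t * q y)"
      by (intro le_cINF_mult that) auto
    then show ?thesis by (simp add: r_def)
  qed
  ultimately have "sublinear r" by (simp add: sublinear_def)
  moreover have "r \<le> q" using lower[of 0] by (simp add: le_fun_def)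
  ultimately have "r = q" by (rule minimal)
  then have "q x \<le> q (x + y) - q y" using lower[of 1 x] by simp
  then show ?thesis using sublinear_add[OF q, of x y] by simp
qed

lemma hahn_banach_sublinear:
  assumes "sublinear p"
  obtains f where "linear f" "\<And>x. f x \<le> p x"
proof -
  obtain q where q: "sublinear q" "q \<le> p" "\<And>r. sublinear r \<Longrightarrow> r \<le> q \<Longrightarrow> r = q"
    using ex_minimal_sublinear[OF assms] by blast
  note add = minimal_sublinear_add[OF q(1,3)]
  \<comment> \<open>Additivity makes \<open>q\<close> odd, which carries homogeneity over to
    negative scalars.\<close>
  have minus: "q (- x) = - q x" for x
    using add[of x "- x"] sublinear_0[OF q(1)] by simp
  have "q (c *\<^sub>R x) = c * q x" for c x
  proof (cases "c \<ge> 0")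
    case True
    then show ?thesis by (rule sublinear_scaleR[OF q(1)])
  next
    case False
    then show ?thesis
      using sublinear_scaleR[OF q(1), of "- c" x] minus[of "c *\<^sub>R x"] by simp
  qed
  then have "linear q" by (intro linearI) (auto simp: add)
  then show ?thesis using q(2) that by (auto simp: le_fun_def)
qed

text \<open>If the convex set had distance at least \<open>d\<close> from the weak limit \<open>x\<close>, a linear functional
  below the functional \<open>p\<close> in the proof would separate the two.\<close>

lemma mazur_approx:
  fixes x :: "'a::real_normed_vector"
  assumes "convex C" and u: "\<And>n. u n \<in> C" and weak: "weakly_converges_to u x" and "d > 0"
  shows "\<exists>c\<in>C. norm (c - x) < d"
proof (rule ccontr)
  assume "\<not> ?thesis"
  then have far: "d \<le> norm (c - x)" if "c \<in> C" for c
    using that by (auto simp: not_less)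
  define I where "I = {0::real..} \<times> C"
  \<comment> \<open>The resulting \<open>p\<close> is the largest sublinear functional below the
    norm with \<open>p (x - c) \<le> - d\<close> for all \<open>c\<close> in \<open>C\<close>. A
    linear functional below it is therefore bounded and keeps the distance \<open>d\<close> between
    its value at \<open>x\<close> and its values on \<open>C\<close>.\<close>
  define g where "g = (\<lambda>v (t, c). norm (v + t *\<^sub>R (c - x)) - t * d)"
  define p where "p = (\<lambda>v. INF i\<in>I. g v i)"
  have "I \<noteq> {}" using u by (auto simp: I_def)
  have bdd: "bdd_below (g v ` I)" for v
  proof (rule bdd_belowI2)
    fix i assume "i \<in> I"
    then obtain t c where i: "i = (t, c)" "t \<ge> 0" "c \<in> C" by (auto simp: I_def)
    have "t * d \<le> norm (t *\<^sub>R (c - x))" using i far by (simp add: mult_left_mono)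
    moreover have "norm (t *\<^sub>R (c - x)) \<le> norm (v + t *\<^sub>R (c - x)) + norm v"
      using norm_triangle_ineq4[of "v + t *\<^sub>R (c - x)" v] by simp
    ultimately show "- norm v \<le> g v i" by (simp add: g_def i)
  qed
  have lower: "p v \<le> norm (v + t *\<^sub>R (c - x)) - t * d" if "t \<ge> 0" "c \<in> C" for v t c
    using cINF_lower[OF bdd, of "(t, c)" v] that by (simp add: p_def g_def I_def)
  have "p (v + w) \<le> p v + p w" for v w
  proof -
    have "p (v + w) \<le> g v i + g w j" if ij': "i \<in> I" "j \<in> I" for i j
    proof -
      obtain t c s b where ij: "i = (t, c)" "j = (s, b)" "t \<in> {0..}" "s \<in> {0..}" "c \<in> C" "b \<in> C"
        using ij' unfolding I_def by blast
      \<comment> \<open>Two points of the cone over \<open>C\<close> add up to one: \<open>a\<close>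
        is the weighted mean of \<open>c\<close> and \<open>b\<close>. If both weights vanish, any
        point of \<open>C\<close> will do.\<close>
      obtain a where a: "a \<in> C" "(t + s) *\<^sub>R a = t *\<^sub>R c + s *\<^sub>R b"
      proof (cases "t + s = 0")
        case True
        then have "t = 0" "s = 0" using ij by auto
        then show ?thesis using that[of c] ij by simp
      next
        case False
        have "(t / (t + s)) *\<^sub>R c + (s / (t + s)) *\<^sub>R b \<in> C"
          using ij False by (intro convexD[OF \<open>convex C\<close>]) (auto simp: add_divide_distrib[symmetric])
        moreover have "(t + s) *\<^sub>R ((t / (t + s)) *\<^sub>R c + (s / (t + s)) *\<^sub>R b) = t *\<^sub>R c + s *\<^sub>R b"
          using False by (simp add: scaleR_add_right)
        ultimately show ?thesis using that by blast
      qed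
      have "p (v + w) \<le> norm (v + w + (t + s) *\<^sub>R (a - x)) - (t + s) * d"
        using ij a by (intro lower) auto
      also have "v + w + (t + s) *\<^sub>R (a - x) = (v + t *\<^sub>R (c - x)) + (w + s *\<^sub>R (b - x))"
        using a(2) by (simp add: algebra_simps)
      also have "norm \<dots> \<le> norm (v + t *\<^sub>R (c - x)) + norm (w + s *\<^sub>R (b - x))"
        by (rule norm_triangle_ineq)
      finally show ?thesis by (simp add: g_def ij algebra_simps)
    qed
    then show ?thesis
      using le_cINF_add[OF \<open>I \<noteq> {}\<close> \<open>I \<noteq> {}\<close>, of "p (v + w)" "g v" "g w"] by (simp add: p_def)
  qed
  moreover have "p (k *\<^sub>R v) \<le> k * p v" if "k > 0" for k v
  proof -
    have "p (k *\<^sub>R v) \<le> k * g v i" if iI: "i \<in> I" for i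
    proof -
      obtain t c where i: "i = (t, c)" "t \<ge> 0" "c \<in> C" using iI by (auto simp: I_def)
      have "p (k *\<^sub>R v) \<le> norm (k *\<^sub>R v + (k * t) *\<^sub>R (c - x)) - (k * t) * d"
        using i \<open>k > 0\<close> by (intro lower) auto
      also have "k *\<^sub>R v + (k * t) *\<^sub>R (c - x) = k *\<^sub>R (v + t *\<^sub>R (c - x))"
        by (simp add: algebra_simps)
      also have "norm \<dots> = k * norm (v + t *\<^sub>R (c - x))" using \<open>k > 0\<close> by simp
      finally show ?thesis by (simp add: g_def i right_diff_distrib mult.assoc)
    qed
    then show ?thesis
      using le_cINF_mult[OF \<open>I \<noteq> {}\<close> that, of "p (k *\<^sub>R v)" "g v"] by (simp add: p_def)
  qed
  ultimately have "sublinear p" by (simp add: sublinear_def)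
  then obtain f where f: "linear f" "\<And>v. f v \<le> p v" using hahn_banach_sublinear by blast
  have f_le: "f v \<le> norm v" for v
    using f(2)[of v] lower[of 0 "u 0" v] u by simp
  have "\<bar>f v\<bar> \<le> norm v" for v
    using f_le[of v] f_le[of "- v"] linear_neg[OF f(1), of v] by simp
  then have "bounded_linear f"
    using f(1) by (intro bounded_linear_intro[where K = 1]) (auto simp: linear_add linear_scale)
  then have blinfun: "blinfun_apply (Blinfun f) = f" by (rule bounded_linear_Blinfun_apply)
  have "d \<le> f (u n) - f x" for n
  proof -
    \<comment> \<open>The index \<open>t = 1\<close>, \<open>c = u n\<close> cancels the norm term
      and leaves \<open>- d\<close>.\<close>
    have "f (- (u n - x)) \<le> - d"
      using f(2)[of "- (u n - x)"] lower[of 1 "u n" "- (u n - x)"] u by simp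
    then show ?thesis by (simp add: linear_diff[OF f(1)])
  qed
  moreover have "(\<lambda>n. f (u n) - f x) \<longlonglongrightarrow> f x - f x"
    using weak blinfun unfolding weakly_converges_to_def by (intro tendsto_diff) (metis, simp)
  ultimately have "d \<le> f x - f x" by (intro LIMSEQ_le_const) auto
  then show False using \<open>d > 0\<close> by simp
qed

text \<open>By Baire's theorem one of the closed sets \<open>T n\<close>, which cover the space,
  contains a ball, and differences of its points bound all operators uniformly near 0. The bound is
  made strictly positive because it later serves as a divisor.\<close>

lemma banach_steinhaus:
  fixes F :: "('a::banach \<Rightarrow>\<^sub>L 'b::real_normed_vector) set"
  assumes bounded: "\<And>x. bounded ((\<lambda>L. blinfun_apply L x) ` F)"
  obtains B where "B > 0" "\<And>L. L \<in> F \<Longrightarrow> norm L \<le> B"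
proof -
  define T where "T = (\<lambda>n::nat. {x. \<forall>L\<in>F. norm (blinfun_apply L x) \<le> real n})"
  have "\<exists>n. interior (T n) \<noteq> {}"
  proof (rule ccontr)
    assume empty: "\<nexists>n. interior (T n) \<noteq> {}"
    have "euclidean interior_of \<Union>(range T) = {}"
    proof (rule Baire_category_alt)
      show "completely_metrizable_space (euclidean :: 'a topology)
          \<or> locally_compact_space (euclidean :: 'a topology) \<and> regular_space (euclidean :: 'a topology)"
        using completely_metrizable_space_euclidean by blast
      fix S assume "S \<in> range T"
      then obtain n where S: "S = T n" by blast
      have "closed (T n)"
        unfolding T_def Ball_def
        by (intro closed_Collect_all closed_Collect_imp closed_Collect_le continuous_intros) auto
      then show "closedin euclidean S \<and> euclidean interior_of S = {}"
        using empty S by auto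
    qed simp
    moreover have "\<Union>(range T) = UNIV"
    proof -
      have "\<exists>n. x \<in> T n" for x
      proof -
        obtain b where b: "\<And>L. L \<in> F \<Longrightarrow> norm (blinfun_apply L x) \<le> b"
          using bounded[of x] by (auto simp: bounded_iff)
        obtain n :: nat where "b \<le> real n" using real_arch_simple by blast
        then show ?thesis using b unfolding T_def by (blast intro: order_trans)
      qed
      then show ?thesis by blast
    qed
    ultimately show False by simp
  qed
  then obtain n x r where r: "r > 0" "ball x r \<subseteq> T n"
    by (auto simp: interior_def open_contains_ball) (meson order_trans)
  have "norm L \<le> 4 * real n / r + 1" if "L \<in> F" for L
  proof -
    \<comment> \<open>Both \<open>x + v\<close> and \<open>x\<close> lie in the ball; their
      difference brings the factor 2.\<close>
    have small: "norm (blinfun_apply L v) \<le> 2 * real n" if "norm v < r" for v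
    proof -
      have "x + v \<in> T n" "x \<in> T n" using r that by (auto simp: dist_norm subset_iff)
      then have "norm (blinfun_apply L (x + v)) \<le> n" "norm (blinfun_apply L x) \<le> n"
        using \<open>L \<in> F\<close> by (auto simp: T_def)
      then show ?thesis
        using norm_triangle_ineq4[of "blinfun_apply L (x + v)" "blinfun_apply L x"]
        by (simp add: blinfun.add_right)
    qed
    \<comment> \<open>Scaling \<open>v\<close> to length \<open>r / 2\<close> turns the bound near 0
      into a bound on the operator norm.\<close>
    have "norm (blinfun_apply L v) \<le> (4 * real n / r) * norm v" for v
    proof (cases "v = 0")
      case False
      then have "norm ((r / (2 * norm v)) *\<^sub>R v) < r" using r by simp
      from small[OF this] show ?thesis
        using r False by (simp add: blinfun.scaleR_right field_simps)
    qed simp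
    then have "norm L \<le> 4 * real n / r"
      using r by (intro norm_blinfun_bound) auto
    then show ?thesis by simp
  qed
  moreover have "4 * real n / r + 1 > 0" using r by (simp add: add_nonneg_pos)
  ultimately show ?thesis using that by blast
qed

section \<open>The spaces \<open>M\<close> and \<open>M\<^sub>0\<close>\<close>

lemma M_spaceI: "(\<And>L. L \<in> S \<Longrightarrow> norm (blinfun_apply L x) \<le> B) \<Longrightarrow> x \<in> M_space S"
  by (auto simp: M_space_def intro!: bdd_aboveI2)

lemma M_space_mono: "S' \<subseteq> S \<Longrightarrow> x \<in> M_space S \<Longrightarrow> x \<in> M_space S'"
  by (auto simp: M_space_def bdd_above_def)

lemma norm_le_sup_op_norm:
  assumes "x \<in> M_space S" "L \<in> S"
  shows "norm (blinfun_apply L x) \<le> sup_op_norm S x"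
  using assms unfolding M_space_def sup_op_norm_def by (intro cSup_upper) auto

lemma sup_op_norm_nonneg:
  assumes "x \<in> M_space S"
  shows "0 \<le> sup_op_norm S x"
  using assms unfolding M_space_def sup_op_norm_def by (intro cSup_upper) auto

lemma sup_op_norm_le:
  assumes "0 \<le> B" "\<And>L. L \<in> S \<Longrightarrow> norm (blinfun_apply L x) \<le> B"
  shows "sup_op_norm S x \<le> B"
  using assms unfolding sup_op_norm_def by (intro cSup_least) auto

lemma norm_add_le_sup_op_norm:
  assumes "x \<in> M_space S" "y \<in> M_space S" "L \<in> S"
  shows "norm (blinfun_apply L (x + y)) \<le> sup_op_norm S x + sup_op_norm S y"
  using norm_triangle_le[OF add_mono[OF norm_le_sup_op_norm[OF assms(1,3)] norm_le_sup_op_norm[OF assms(2,3)]]]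
  by (simp add: blinfun.add_right)

lemma norm_scaleR_le_sup_op_norm:
  assumes "x \<in> M_space S" "L \<in> S"
  shows "norm (blinfun_apply L (c *\<^sub>R x)) \<le> \<bar>c\<bar> * sup_op_norm S x"
  using norm_le_sup_op_norm[OF assms] by (simp add: blinfun.scaleR_right mult_left_mono)

lemma subspace_M_space: "subspace (M_space S)"
proof (rule subspaceI)
  show "0 \<in> M_space S" by (rule M_spaceI[where B = 0]) simp
qed (blast intro: M_spaceI norm_add_le_sup_op_norm norm_scaleR_le_sup_op_norm)+

lemma sup_op_norm_add:
  assumes "x \<in> M_space S" "y \<in> M_space S"
  shows "sup_op_norm S (x + y) \<le> sup_op_norm S x + sup_op_norm S y"
  by (intro sup_op_norm_le norm_add_le_sup_op_norm add_nonneg_nonneg sup_op_norm_nonneg assms)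

lemma sup_op_norm_scaleR:
  assumes "x \<in> M_space S"
  shows "sup_op_norm S (c *\<^sub>R x) \<le> \<bar>c\<bar> * sup_op_norm S x"
  by (intro sup_op_norm_le norm_scaleR_le_sup_op_norm mult_nonneg_nonneg sup_op_norm_nonneg assms) auto

section \<open>The upper limit and the space M_0\<close>

lemma limsup_escaping_le:
  assumes x: "x \<in> M_space (topspace T)" and K: "compactin T K" and "0 \<le> c"
    and le: "\<And>L. L \<in> topspace T - K \<Longrightarrow> norm (blinfun_apply L x) \<le> c"
  shows "limsup_escaping T x \<le> c"
proof -
  have "limsup_escaping T x \<le> sup_op_norm (topspace T - K) x"
    unfolding limsup_escaping_def
    using K by (intro cINF_lower bdd_belowI2[where m = 0] sup_op_norm_nonneg M_space_mono[OF _ x]) auto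
  also have "\<dots> \<le> c" using \<open>0 \<le> c\<close> le by (rule sup_op_norm_le)
  finally show ?thesis .
qed

lemma limsup_escaping_nonneg:
  assumes "x \<in> M_space (topspace T)"
  shows "0 \<le> limsup_escaping T x"
  unfolding limsup_escaping_def
proof (rule cINF_greatest)
  \<comment> \<open>The empty compact set keeps the family nonempty, as a real infimum
    requires.\<close>
  show "{K. compactin T K} \<noteq> {}" using compactin_empty by blast
qed (auto intro!: sup_op_norm_nonneg M_space_mono[OF _ assms])

lemma limsup_escaping_lessD:
  assumes x: "x \<in> M_space (topspace T)" and "limsup_escaping T x < c"
  obtains K where "compactin T K" "\<And>L. L \<in> topspace T - K \<Longrightarrow> norm (blinfun_apply L x) \<le> c"
proof -
  obtain K where K: "compactin T K" "sup_op_norm (topspace T - K) x < c"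
    using cInf_lessD[of "(\<lambda>K. sup_op_norm (topspace T - K) x) ` {K. compactin T K}" c] assms(2)
    unfolding limsup_escaping_def by (auto intro: compactin_empty)
  show ?thesis
  proof (rule that[OF K(1)])
    fix L assume "L \<in> topspace T - K"
    then have "norm (blinfun_apply L x) \<le> sup_op_norm (topspace T - K) x"
      by (intro norm_le_sup_op_norm M_space_mono[OF _ x]) auto
    then show "norm (blinfun_apply L x) \<le> c" using K(2) by simp
  qed
qed

text \<open>This form without infima is the one suited to sums and multiples, where compact sets are
  united and errors are split.\<close>

lemma M0_space_iff:
  "x \<in> M0_space T \<longleftrightarrow> x \<in> M_space (topspace T) \<and>
    (\<forall>e>0. \<exists>K. compactin T K \<and> (\<forall>L\<in>topspace T - K. norm (blinfun_apply L x) \<le> e))"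
    (is "_ \<longleftrightarrow> _ \<and> ?small")
proof (cases "x \<in> M_space (topspace T)")
  case True
  have "limsup_escaping T x = 0 \<longleftrightarrow> ?small"
  proof
    assume "limsup_escaping T x = 0"
    then show ?small using limsup_escaping_lessD[OF True] by metis
  next
    assume ?small
    then have "limsup_escaping T x \<le> e" if "e > 0" for e
      using limsup_escaping_le[OF True] that by (meson less_imp_le)
    then have "limsup_escaping T x \<le> 0" by (rule field_le_epsilon) simp
    then show "limsup_escaping T x = 0" using limsup_escaping_nonneg[OF True] by simp
  qed
  then show ?thesis using True by (simp add: M0_space_def)
qed (simp add: M0_space_def)

lemma M0_space_smallD:
  assumes "x \<in> M0_space T" "e > 0"
  obtains K where "compactin T K" "\<And>L. L \<in> topspace T - K \<Longrightarrow> norm (blinfun_apply L x) \<le> e"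
  using assms unfolding M0_space_iff by blast

lemma M0_subset_M: "x \<in> M0_space T \<Longrightarrow> x \<in> M_space (topspace T)"
  by (simp add: M0_space_def)

text \<open>Off a suitable compact set \<open>L z\<close> is negligible, so \<open>L x\<close> is
  almost \<open>L (x - z)\<close> there. This gives the lower bound for the distance, and also the
  closedness of \<open>M0_space\<close>.\<close>

lemma limsup_escaping_le_diff:
  assumes x: "x \<in> M_space (topspace T)" and z: "z \<in> M0_space T"
  shows "limsup_escaping T x \<le> sup_op_norm (topspace T) (x - z)"
proof (rule field_le_epsilon)
  fix e :: real assume "e > 0"
  obtain K where K: "compactin T K" "\<And>L. L \<in> topspace T - K \<Longrightarrow> norm (blinfun_apply L z) \<le> e"
    using M0_space_smallD[OF z \<open>e > 0\<close>] by blast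
  have diff: "x - z \<in> M_space (topspace T)"
    by (intro subspace_diff[OF subspace_M_space] x M0_subset_M z)
  show "limsup_escaping T x \<le> sup_op_norm (topspace T) (x - z) + e"
  proof (rule limsup_escaping_le[OF x K(1)])
    show "0 \<le> sup_op_norm (topspace T) (x - z) + e"
      using sup_op_norm_nonneg[OF diff] \<open>e > 0\<close> by simp
    fix L assume L: "L \<in> topspace T - K"
    have "norm (blinfun_apply L (x - z) + blinfun_apply L z)
        \<le> sup_op_norm (topspace T) (x - z) + e"
      using L by (intro norm_triangle_le add_mono norm_le_sup_op_norm[OF diff] K(2)) auto
    then show "norm (blinfun_apply L x) \<le> sup_op_norm (topspace T) (x - z) + e"
      by (simp add: blinfun.diff_right)
  qed
qed

lemma M0_space_closed:
  assumes x: "x \<in> M_space (topspace T)"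
    and approx: "\<And>e. e > 0 \<Longrightarrow> \<exists>z\<in>M0_space T. sup_op_norm (topspace T) (x - z) \<le> e"
  shows "x \<in> M0_space T"
proof -
  have "limsup_escaping T x \<le> 0"
  proof (rule field_le_epsilon)
    fix e :: real assume "e > 0"
    with approx obtain z where "z \<in> M0_space T" "sup_op_norm (topspace T) (x - z) \<le> e" by blast
    then show "limsup_escaping T x \<le> 0 + e"
      using limsup_escaping_le_diff[OF x] by fastforce
  qed
  then show ?thesis
    using x limsup_escaping_nonneg[OF x] by (simp add: M0_space_def)
qed

lemma subspace_M0_space: "subspace (M0_space T)"
proof (rule subspaceI)
  show "0 \<in> M0_space T"
    by (auto simp: M0_space_iff subspace_0[OF subspace_M_space] intro!: exI[of _ "{}"])
next
  fix x y assume xy: "x \<in> M0_space T" "y \<in> M0_space T"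
  have "\<exists>K. compactin T K \<and> (\<forall>L\<in>topspace T - K. norm (blinfun_apply L (x + y)) \<le> e)"
    if e: "e > 0" for e
  proof -
    have "e / 2 > 0" using that by simp
    then obtain K J where
      K: "compactin T K" "\<And>L. L \<in> topspace T - K \<Longrightarrow> norm (blinfun_apply L x) \<le> e / 2" and
      J: "compactin T J" "\<And>L. L \<in> topspace T - J \<Longrightarrow> norm (blinfun_apply L y) \<le> e / 2"
      using M0_space_smallD xy by metis
    have "norm (blinfun_apply L (x + y)) \<le> e" if "L \<in> topspace T - (K \<union> J)" for L
      using K(2)[of L] J(2)[of L] that norm_triangle_ineq[of "blinfun_apply L x" "blinfun_apply L y"]
      by (simp add: blinfun.add_right)
    then show ?thesis using compactin_Un[OF K(1) J(1)] by blast
  qed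
  then show "x + y \<in> M0_space T"
    using subspace_add[OF subspace_M_space M0_subset_M[OF xy(1)] M0_subset_M[OF xy(2)]]
    by (simp add: M0_space_iff)
next
  fix c x assume x: "x \<in> M0_space T"
  have "\<exists>K. compactin T K \<and> (\<forall>L\<in>topspace T - K. norm (blinfun_apply L (c *\<^sub>R x)) \<le> e)"
    if "e > 0" for e
  proof -
    \<comment> \<open>Adding 1 covers the case \<open>c = 0\<close>.\<close>
    have "e / (\<bar>c\<bar> + 1) > 0" using that by (simp add: add_nonneg_pos)
    then obtain K where
      K: "compactin T K" "\<And>L. L \<in> topspace T - K \<Longrightarrow> norm (blinfun_apply L x) \<le> e / (\<bar>c\<bar> + 1)"
      using M0_space_smallD[OF x] by metis
    have "norm (blinfun_apply L (c *\<^sub>R x)) \<le> e" if "L \<in> topspace T - K" for L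
    proof -
      have "\<bar>c\<bar> * norm (blinfun_apply L x) \<le> (\<bar>c\<bar> + 1) * (e / (\<bar>c\<bar> + 1))"
        using K(2)[OF that] by (intro mult_mono) auto
      also have "\<dots> = e" by simp
      finally show ?thesis by (simp add: blinfun.scaleR_right)
    qed
    then show ?thesis using K(1) by blast
  qed
  then show "c *\<^sub>R x \<in> M0_space T"
    using subspace_scale[OF subspace_M_space M0_subset_M[OF x]] by (simp add: M0_space_iff)
qed

section \<open>Approximation from \<open>M\<^sub>0\<close>\<close>

text \<open>Assumption (A) gives only weak convergence. Mazur's lemma turns it into norm
  approximation from the convex set \<open>S\<close>, in which the bound on the M-norm is built in.
  Banach--Steinhaus bounds the operators in \<open>K\<close>, so that closeness in the domain
  becomes uniform closeness of the values on \<open>K\<close>.\<close>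

lemma approx_on_compact:
  fixes T :: "('x::banach \<Rightarrow>\<^sub>L 'y::real_normed_vector) topology"
  assumes cont: "\<And>x. continuous_map T euclidean (\<lambda>L. blinfun_apply L x)"
    and A: "assumption_A T" and w: "w \<in> M_space (topspace T)"
    and K: "compactin T K" and "d > 0"
  obtains z where "z \<in> M0_space T" "sup_op_norm (topspace T) z \<le> sup_op_norm (topspace T) w"
    "\<And>L. L \<in> K \<Longrightarrow> norm (blinfun_apply L (z - w)) \<le> d"
proof -
  let ?N = "sup_op_norm (topspace T)"
  define S where "S = {z \<in> M0_space T. ?N z \<le> ?N w}"
  obtain u where u: "\<forall>n. u n \<in> M0_space T" "bdd_above (range (\<lambda>n. ?N (u n)))"
      "weakly_converges_to u w" "(SUP n. ?N (u n)) \<le> ?N w"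
    using bspec[OF A[unfolded assumption_A_def] w] by (elim exE conjE)
  have "u n \<in> S" for n
    using u cSUP_upper[OF _ u(2), of n] by (auto simp: S_def intro: order_trans)
  moreover have "convex S"
  proof (rule convexI)
    fix a b :: 'x and s t :: real
    assume ab: "a \<in> S" "b \<in> S" and st: "0 \<le> s" "0 \<le> t" "s + t = 1"
    then have M0: "s *\<^sub>R a \<in> M0_space T" "t *\<^sub>R b \<in> M0_space T"
      by (auto simp: S_def intro: subspace_scale[OF subspace_M0_space])
    have "?N (s *\<^sub>R a + t *\<^sub>R b) \<le> ?N (s *\<^sub>R a) + ?N (t *\<^sub>R b)"
      by (intro sup_op_norm_add M0_subset_M M0)
    also have "\<dots> \<le> s * ?N a + t * ?N b"
      using ab st sup_op_norm_scaleR[of a "topspace T" s] sup_op_norm_scaleR[of b "topspace T" t]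
      by (simp add: S_def M0_subset_M add_mono)
    also have "\<dots> \<le> ?N w"
      using ab st by (intro convex_bound_le) (auto simp: S_def)
    finally show "s *\<^sub>R a + t *\<^sub>R b \<in> S"
      using subspace_add[OF subspace_M0_space M0] by (simp add: S_def)
  qed
  moreover have bounded: "bounded ((\<lambda>L. blinfun_apply L x) ` K)" for x
    using image_compactin[OF K cont] by (simp add: compact_imp_bounded)
  obtain B where B: "B > 0" "\<And>L. L \<in> K \<Longrightarrow> norm L \<le> B"
    using banach_steinhaus[OF bounded] by blast
  ultimately obtain z where z: "z \<in> S" "norm (z - w) < d / B"
    using mazur_approx[of S u w "d / B"] u(3) \<open>d > 0\<close> by auto
  have "norm (blinfun_apply L (z - w)) \<le> d" if "L \<in> K" for L
  proof -
    have "norm (blinfun_apply L (z - w)) \<le> B * (d / B)"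
      using z B(1) B(2)[OF that]
      by (intro order_trans[OF norm_blinfun] mult_mono) auto
    then show ?thesis using B by simp
  qed
  then show ?thesis using z(1) by (intro that[of z]) (auto simp: S_def)
qed

text \<open>Sliding hump: each new summand is close to \<open>w\<close> on a compact set outside of which the
  previous ones are small, so at every single \<open>L\<close> at most one summand is out of control.\<close>

lemma sliding_hump_sum:
  fixes T :: "('x::banach \<Rightarrow>\<^sub>L 'y::real_normed_vector) topology"
  assumes cont: "\<And>x. continuous_map T euclidean (\<lambda>L. blinfun_apply L x)"
    and A: "assumption_A T" and w: "w \<in> M_space (topspace T)"
    and K: "compactin T K" and "d > 0"
  shows "\<exists>s\<in>M0_space T. sup_op_norm (topspace T) s \<le> real n * sup_op_norm (topspace T) w
    \<and> (\<forall>L\<in>K. norm (blinfun_apply L (s - real n *\<^sub>R w)) \<le> real n * d)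
    \<and> (\<forall>L\<in>topspace T. \<exists>r\<in>{0..real n}. norm (blinfun_apply L (s - r *\<^sub>R w))
        \<le> real n * d + sup_op_norm (topspace T) w)"
  using K
proof (induction n arbitrary: K)
  case 0
  have "sup_op_norm (topspace T) 0 \<le> 0" by (rule sup_op_norm_le) auto
  then show ?case
    using subspace_0[OF subspace_M0_space] sup_op_norm_nonneg[OF w] by (intro bexI[of _ 0]) auto
next
  case (Suc n)
  let ?N = "sup_op_norm (topspace T)"
  obtain z where z: "z \<in> M0_space T" "?N z \<le> ?N w"
      and zK: "\<And>L. L \<in> K \<Longrightarrow> norm (blinfun_apply L (z - w)) \<le> d"
    using approx_on_compact[OF cont A w Suc.prems \<open>d > 0\<close>] by blast
  obtain J where J: "compactin T J" "\<And>L. L \<in> topspace T - J \<Longrightarrow> norm (blinfun_apply L z) \<le> d"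
    using M0_space_smallD[OF z(1) \<open>d > 0\<close>] by blast
  \<comment> \<open>The summand \<open>z\<close> may be large on \<open>J\<close>. Applying the
    induction hypothesis to \<open>K \<union> J\<close> makes the other \<open>n\<close> summands
    close to \<open>w\<close> there; this is why \<open>K\<close> is generalized.\<close>
  obtain s where s: "s \<in> M0_space T" "?N s \<le> real n * ?N w"
      and sKJ: "\<And>L. L \<in> K \<union> J \<Longrightarrow> norm (blinfun_apply L (s - real n *\<^sub>R w)) \<le> real n * d"
      and sT: "\<And>L. L \<in> topspace T \<Longrightarrow>
        \<exists>r\<in>{0..real n}. norm (blinfun_apply L (s - r *\<^sub>R w)) \<le> real n * d + ?N w"
    using Suc.IH[OF compactin_Un[OF Suc.prems J(1)]] by auto
  have "z + s \<in> M0_space T" by (intro subspace_add[OF subspace_M0_space] z s)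
  moreover have "?N (z + s) \<le> real (Suc n) * ?N w"
    using sup_op_norm_add[OF M0_subset_M[OF z(1)] M0_subset_M[OF s(1)]] z s
    by (simp add: algebra_simps)
  moreover have "norm (blinfun_apply L (z + s - real (Suc n) *\<^sub>R w)) \<le> real (Suc n) * d"
    if "L \<in> K" for L
  proof -
    have "blinfun_apply L (z + s - real (Suc n) *\<^sub>R w)
        = blinfun_apply L (z - w) + blinfun_apply L (s - real n *\<^sub>R w)"
      by (simp add: blinfun.bilinear_simps algebra_simps)
    also have "norm \<dots> \<le> d + real n * d"
      using that by (intro norm_triangle_le add_mono zK sKJ) auto
    finally show ?thesis by (simp add: algebra_simps)
  qed
  moreover have "\<exists>r\<in>{0..real (Suc n)}. norm (blinfun_apply L (z + s - r *\<^sub>R w))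
      \<le> real (Suc n) * d + ?N w" if L: "L \<in> topspace T" for L
  proof (cases "L \<in> J")
    case True
    \<comment> \<open>Here \<open>z\<close> is the summand out of control: only
      \<open>?N z \<le> ?N w\<close> is used, and the others give \<open>r = n\<close>.\<close>
    have "norm (blinfun_apply L z + blinfun_apply L (s - real n *\<^sub>R w)) \<le> ?N w + real n * d"
      using norm_le_sup_op_norm[OF M0_subset_M[OF z(1)] L] z(2) True
      by (intro norm_triangle_le add_mono sKJ) auto
    then have "norm (blinfun_apply L (z + s - real n *\<^sub>R w)) \<le> real (Suc n) * d + ?N w"
      using \<open>d > 0\<close> by (simp add: blinfun.bilinear_simps algebra_simps)
    then show ?thesis by (intro bexI[of _ "real n"]) auto
  next
    case False
    \<comment> \<open>Off \<open>J\<close> the summand \<open>z\<close> costs only \<open>d\<close>,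
      and the \<open>r\<close> of the shorter sum is kept.\<close>
    obtain r where r: "r \<in> {0..real n}"
        "norm (blinfun_apply L (s - r *\<^sub>R w)) \<le> real n * d + ?N w"
      using sT[OF L] by blast
    have "norm (blinfun_apply L z + blinfun_apply L (s - r *\<^sub>R w)) \<le> d + (real n * d + ?N w)"
      using J(2)[of L] False L by (intro norm_triangle_le add_mono r) auto
    then have "norm (blinfun_apply L (z + s - r *\<^sub>R w)) \<le> real (Suc n) * d + ?N w"
      by (simp add: blinfun.bilinear_simps algebra_simps)
    then show ?thesis using r(1) by (intro bexI[of _ r]) auto
  qed
  ultimately show ?case by blast
qed

text \<open>Dividing the sum of \<open>n\<close> humps by \<open>n\<close> leaves the error
  \<open>e / 2\<close> of a single hump unchanged and shrinks the one uncontrolled summand to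
  \<open>?N w / n\<close>, which is at most \<open>e / 2\<close> for large \<open>n\<close>.\<close>

lemma cutoff:
  fixes T :: "('x::banach \<Rightarrow>\<^sub>L 'y::real_normed_vector) topology"
  assumes cont: "\<And>x. continuous_map T euclidean (\<lambda>L. blinfun_apply L x)"
    and A: "assumption_A T" and w: "w \<in> M_space (topspace T)"
    and K: "compactin T K" and "e > 0"
  obtains z where "z \<in> M0_space T" "sup_op_norm (topspace T) z \<le> sup_op_norm (topspace T) w"
    "\<And>L. L \<in> K \<Longrightarrow> norm (blinfun_apply L (z - w)) \<le> e"
    "\<And>L. L \<in> topspace T \<Longrightarrow> \<exists>r\<in>{0..1}. norm (blinfun_apply L (z - r *\<^sub>R w)) \<le> e"
proof -
  let ?N = "sup_op_norm (topspace T)"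
  obtain n :: nat where n: "n > 0" "?N w \<le> real n * (e / 2)"
  proof -
    obtain n :: nat where "2 * ?N w / e \<le> real n" using real_arch_simple by blast
    then have "?N w \<le> real (Suc n) * (e / 2)" using \<open>e > 0\<close> by (simp add: field_simps)
    then show ?thesis using that by blast
  qed
  have "e / 2 > 0" using \<open>e > 0\<close> by simp
  from sliding_hump_sum[OF cont A w K this, of n]
  obtain s where s: "s \<in> M0_space T" "?N s \<le> real n * ?N w"
      and sK: "\<And>L. L \<in> K \<Longrightarrow> norm (blinfun_apply L (s - real n *\<^sub>R w)) \<le> real n * (e / 2)"
      and sT: "\<And>L. L \<in> topspace T \<Longrightarrow>
        \<exists>r\<in>{0..real n}. norm (blinfun_apply L (s - r *\<^sub>R w)) \<le> real n * (e / 2) + ?N w"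
    by blast
  define z where "z = (1 / real n) *\<^sub>R s"
  have scale: "norm (blinfun_apply L (z - (r / real n) *\<^sub>R w)) = norm (blinfun_apply L (s - r *\<^sub>R w)) / real n"
    for L r
  proof -
    have "z - (r / real n) *\<^sub>R w = (1 / real n) *\<^sub>R (s - r *\<^sub>R w)"
      by (simp add: z_def scaleR_diff_right)
    then show ?thesis using n(1) by (simp add: blinfun.scaleR_right)
  qed
  show ?thesis
  proof (rule that[of z])
    show "z \<in> M0_space T" unfolding z_def by (intro subspace_scale[OF subspace_M0_space] s)
    show "?N z \<le> ?N w"
    proof -
      have "?N z \<le> ?N s / real n"
        using sup_op_norm_scaleR[OF M0_subset_M[OF s(1)], of "1 / real n"] by (simp add: z_def)
      also have "\<dots> \<le> ?N w" using s(2) n(1) by (simp add: field_simps)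
      finally show ?thesis .
    qed
    show "norm (blinfun_apply L (z - w)) \<le> e" if "L \<in> K" for L
    proof -
      have "norm (blinfun_apply L (z - w)) = norm (blinfun_apply L (s - real n *\<^sub>R w)) / real n"
        using scale[of L "real n"] n(1) by simp
      also have "\<dots> \<le> e / 2" using sK[OF that] n(1) by (simp add: field_simps)
      finally show ?thesis using \<open>e > 0\<close> by simp
    qed
    show "\<exists>r\<in>{0..1}. norm (blinfun_apply L (z - r *\<^sub>R w)) \<le> e" if L: "L \<in> topspace T" for L
    proof -
      obtain r where r: "r \<in> {0..real n}"
          "norm (blinfun_apply L (s - r *\<^sub>R w)) \<le> real n * (e / 2) + ?N w"
        using sT[OF L] by blast
      then have "norm (blinfun_apply L (s - r *\<^sub>R w)) / real n \<le> e"
        using n by (simp add: field_simps)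
      then show ?thesis
        using r(1) n(1) scale[of L r] by (intro bexI[of _ "r / real n"]) auto
    qed
  qed
qed

text \<open>Subtracting a small multiple of a cutoff of \<open>w\<close> shrinks \<open>L w\<close> where it is large, while
  elsewhere it multiplies \<open>L w\<close>, up to an error, by a number in \<open>[0, 1]\<close>. A correction whose
  norm is at most the excess \<open>e\<close> therefore suffices.\<close>

lemma reduce_excess:
  fixes T :: "('x::banach \<Rightarrow>\<^sub>L 'y::real_normed_vector) topology"
  assumes cont: "\<And>x. continuous_map T euclidean (\<lambda>L. blinfun_apply L x)"
    and A: "assumption_A T" and w: "w \<in> M_space (topspace T)"
    and "e > 0" "d > 0" and excess: "sup_op_norm (topspace T) w \<le> limsup_escaping T w + e"
  obtains z where "z \<in> M0_space T" "sup_op_norm (topspace T) z \<le> e"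
    "sup_op_norm (topspace T) (w - z) \<le> limsup_escaping T w + d"
proof -
  let ?N = "sup_op_norm (topspace T)"
  define l where "l = limsup_escaping T w"
  have "l \<ge> 0" unfolding l_def by (rule limsup_escaping_nonneg[OF w])
  obtain K where K: "compactin T K"
      "\<And>L. L \<in> topspace T - K \<Longrightarrow> norm (blinfun_apply L w) \<le> l + d / 2"
    using limsup_escaping_lessD[OF w, of "l + d / 2"] \<open>d > 0\<close> by (auto simp: l_def)
  have "d / 2 > 0" using \<open>d > 0\<close> by simp
  from cutoff[OF cont A w K(1) this]
  obtain z where z: "z \<in> M0_space T" "?N z \<le> ?N w"
      and zK: "\<And>L. L \<in> K \<Longrightarrow> norm (blinfun_apply L (z - w)) \<le> d / 2"
      and zT: "\<And>L. L \<in> topspace T \<Longrightarrow> \<exists>r\<in>{0..1}. norm (blinfun_apply L (z - r *\<^sub>R w)) \<le> d / 2"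
    by blast
  \<comment> \<open>With this \<open>t\<close> the correction has norm at most
    \<open>t * (l + e) = e\<close>, while on \<open>K\<close>, where \<open>r = 1\<close>, the
    operators are reduced to at most \<open>(1 - t) * (l + e) = l\<close>, up to the error of the
    cutoff.\<close>
  define t where "t = e / (l + e)"
  have t: "0 \<le> t" "t \<le> 1" "t * (l + e) = e" "(1 - t) * (l + e) = l"
    using \<open>l \<ge> 0\<close> \<open>e > 0\<close> by (auto simp: t_def field_simps)
  have split: "norm (blinfun_apply L (w - t *\<^sub>R z)) \<le> (1 - t * r) * norm (blinfun_apply L w) + d / 2"
    if "r \<in> {0..1}" "norm (blinfun_apply L (z - r *\<^sub>R w)) \<le> d / 2" for L r
  proof -
    have "t * r \<le> 1" using t that by (simp add: mult_le_one)
    have "blinfun_apply L (w - t *\<^sub>R z)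
        = (1 - t * r) *\<^sub>R blinfun_apply L w - t *\<^sub>R blinfun_apply L (z - r *\<^sub>R w)"
      by (simp add: blinfun.bilinear_simps algebra_simps)
    also have "norm \<dots> \<le> norm ((1 - t * r) *\<^sub>R blinfun_apply L w)
        + norm (t *\<^sub>R blinfun_apply L (z - r *\<^sub>R w))"
      by (rule norm_triangle_ineq4)
    also have "\<dots> \<le> (1 - t * r) * norm (blinfun_apply L w) + 1 * (d / 2)"
      using t that \<open>t * r \<le> 1\<close> mult_mono[of t 1 _ "d / 2"] by (intro add_mono) auto
    finally show ?thesis by simp
  qed
  have "norm (blinfun_apply L (w - t *\<^sub>R z)) \<le> l + d" if L: "L \<in> topspace T" for L
  proof (cases "L \<in> K")
    case True
    have "norm (blinfun_apply L (w - t *\<^sub>R z)) \<le> (1 - t) * norm (blinfun_apply L w) + d / 2"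
      using split[of 1 L] zK[OF True] by simp
    also have "(1 - t) * norm (blinfun_apply L w) \<le> (1 - t) * (l + e)"
      using norm_le_sup_op_norm[OF w L] excess t by (intro mult_left_mono) (auto simp: l_def)
    finally show ?thesis using t \<open>d > 0\<close> by simp
  next
    case False
    \<comment> \<open>Off \<open>K\<close> any \<open>r\<close> in [0, 1] will do, since
      \<open>L w\<close> already has norm at most \<open>l + d / 2\<close>.\<close>
    obtain r where r: "r \<in> {0..1}" "norm (blinfun_apply L (z - r *\<^sub>R w)) \<le> d / 2"
      using zT[OF L] by blast
    have "(1 - t * r) * norm (blinfun_apply L w) \<le> 1 * norm (blinfun_apply L w)"
      using t r(1) by (intro mult_right_mono) auto
    also have "\<dots> \<le> l + d / 2" using K(2) L False by simp
    finally show ?thesis using split[OF r] by simp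
  qed
  then have "?N (w - t *\<^sub>R z) \<le> l + d"
    using \<open>l \<ge> 0\<close> \<open>d > 0\<close> by (intro sup_op_norm_le) auto
  moreover have "?N (t *\<^sub>R z) \<le> e"
  proof -
    have "?N (t *\<^sub>R z) \<le> t * ?N z" using sup_op_norm_scaleR[OF M0_subset_M[OF z(1)], of t] t by simp
    also have "\<dots> \<le> t * (l + e)" using z(2) excess t by (intro mult_left_mono) (auto simp: l_def)
    finally show ?thesis using t by simp
  qed
  ultimately show ?thesis
    using that[of "t *\<^sub>R z"] subspace_scale[OF subspace_M0_space z(1)] by (simp add: l_def)
qed

section \<open>Existence of a best approximation\<close>

lemma limsup_escaping_diff_M0:
  assumes x: "x \<in> M_space (topspace T)" and z: "z \<in> M0_space T"
  shows "limsup_escaping T (x - z) = limsup_escaping T x"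
proof -
  have le: "limsup_escaping T (x - z) \<le> limsup_escaping T x"
    if x: "x \<in> M_space (topspace T)" and z: "z \<in> M0_space T" for x z
  proof (rule field_le_epsilon)
    fix e :: real assume "e > 0"
    then have "e / 2 > 0" "limsup_escaping T x < limsup_escaping T x + e / 2" by auto
    obtain K J where
      K: "compactin T K" "\<And>L. L \<in> topspace T - K \<Longrightarrow> norm (blinfun_apply L x) \<le> limsup_escaping T x + e / 2" and
      J: "compactin T J" "\<And>L. L \<in> topspace T - J \<Longrightarrow> norm (blinfun_apply L z) \<le> e / 2"
      using limsup_escaping_lessD[OF x] M0_space_smallD[OF z] \<open>e / 2 > 0\<close>
        \<open>limsup_escaping T x < limsup_escaping T x + e / 2\<close> by metis
    show "limsup_escaping T (x - z) \<le> limsup_escaping T x + e"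
    proof (rule limsup_escaping_le[OF _ compactin_Un[OF K(1) J(1)]])
      show "x - z \<in> M_space (topspace T)"
        by (intro subspace_diff[OF subspace_M_space] x M0_subset_M z)
      show "0 \<le> limsup_escaping T x + e"
        using limsup_escaping_nonneg[OF x] \<open>e > 0\<close> by simp
      fix L assume "L \<in> topspace T - (K \<union> J)"
      then show "norm (blinfun_apply L (x - z)) \<le> limsup_escaping T x + e"
        using K(2)[of L] J(2)[of L] norm_triangle_ineq4[of "blinfun_apply L x" "blinfun_apply L z"]
        by (simp add: blinfun.diff_right)
    qed
  qed
  have "x - z \<in> M_space (topspace T)"
    by (intro subspace_diff[OF subspace_M_space] x M0_subset_M z)
  \<comment> \<open>The reverse inequality is the same one for \<open>x - z\<close> and
    \<open>- z\<close>, since \<open>(x - z) - (- z) = x\<close>.\<close>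
  from le[OF this subspace_neg[OF subspace_M0_space z]] le[OF x z] show ?thesis by simp
qed

text \<open>Each step halves the bound on the excess and moves the approximant by at most the
  previous bound. The moves are summable, so the approximants converge, and in the limit no excess
  is left.\<close>

lemma M0_space_proximinal:
  fixes T :: "('x::banach \<Rightarrow>\<^sub>L 'y::real_normed_vector) topology"
  assumes cont: "\<And>x. continuous_map T euclidean (\<lambda>L. blinfun_apply L x)"
    and A: "assumption_A T"
    and complete: "banach_under (M_space (topspace T)) (sup_op_norm (topspace T))"
    and x: "x \<in> M_space (topspace T)"
  obtains x0 where "x0 \<in> M0_space T" "sup_op_norm (topspace T) (x - x0) \<le> limsup_escaping T x"
proof -
  let ?M = "M_space (topspace T)" and ?N = "sup_op_norm (topspace T)"
  define l where "l = limsup_escaping T x"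
  \<comment> \<open>The iteration starts at 0 with excess at most \<open>C\<close>, because
    \<open>l \<ge> 0\<close>. The added 1 keeps \<open>C\<close> positive even if
    \<open>?N x = 0\<close>.\<close>
  define C where "C = ?N x + 1"
  have "C > 0" using sup_op_norm_nonneg[OF x] by (simp add: C_def)
  define P where "P = (\<lambda>(n::nat) y. y \<in> M0_space T \<and> ?N (x - y) \<le> l + C / 2 ^ n)"
  have "\<exists>y. \<forall>n. P n (y n) \<and> ?N (y (Suc n) - y n) \<le> C / 2 ^ n"
  proof (rule dependent_nat_choice)
    have "0 \<le> l" unfolding l_def by (rule limsup_escaping_nonneg[OF x])
    then show "\<exists>y. P 0 y"
      using subspace_0[OF subspace_M0_space] by (intro exI[of _ 0]) (simp add: P_def C_def)
  next
    fix y n assume "P n y"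
    then have y: "y \<in> M0_space T" "?N (x - y) \<le> l + C / 2 ^ n" by (auto simp: P_def)
    have xy: "x - y \<in> ?M" by (intro subspace_diff[OF subspace_M_space] x M0_subset_M y)
    \<comment> \<open>The upper limit of the remainder stays \<open>l\<close>, so every step aims at
      the same value.\<close>
    have "limsup_escaping T (x - y) = l"
      unfolding l_def by (rule limsup_escaping_diff_M0[OF x y(1)])
    then obtain z where z: "z \<in> M0_space T" "?N z \<le> C / 2 ^ n" "?N (x - y - z) \<le> l + C / 2 ^ Suc n"
      using reduce_excess[OF cont A xy, of "C / 2 ^ n" "C / 2 ^ Suc n"] y(2) \<open>C > 0\<close> by auto
    then show "\<exists>y'. P (Suc n) y' \<and> ?N (y' - y) \<le> C / 2 ^ n"
      using subspace_add[OF subspace_M0_space y(1) z(1)]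
      by (intro exI[of _ "y + z"]) (simp add: P_def diff_diff_eq)
  qed
  then obtain y where y0: "\<And>n. y n \<in> M0_space T" and yx: "\<And>n. ?N (x - y n) \<le> l + C / 2 ^ n"
      and step: "\<And>n. ?N (y (Suc n) - y n) \<le> C / 2 ^ n"
    by (auto simp: P_def)
  have yM: "y m - y n \<in> ?M" for m n
    by (intro subspace_diff[OF subspace_M_space] M0_subset_M y0)
  \<comment> \<open>The right-hand side is the exact geometric sum of the step bounds; the
    subtracted term lets the induction absorb the next step.\<close>
  have far: "?N (y (n + k) - y n) \<le> 2 * C / 2 ^ n - 2 * C / 2 ^ (n + k)" for n k
  proof (induction k)
    case 0
    have "?N 0 \<le> 0" by (rule sup_op_norm_le) auto
    then show ?case by simp
  next
    case (Suc k)
    have "?N ((y (Suc (n + k)) - y (n + k)) + (y (n + k) - y n))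
        \<le> C / 2 ^ (n + k) + (2 * C / 2 ^ n - 2 * C / 2 ^ (n + k))"
      by (intro order_trans[OF sup_op_norm_add] add_mono step Suc.IH yM)
    then show ?case by (simp add: field_simps)
  qed
  have small: "\<exists>n0. \<forall>n\<ge>n0. c / 2 ^ n < e" if "e > 0" for c e :: real
  proof -
    have "(\<lambda>n. c * (1 / 2) ^ n) \<longlonglongrightarrow> c * 0"
      by (intro tendsto_mult tendsto_const LIMSEQ_power_zero) simp
    then have "\<forall>\<^sub>F n in sequentially. c * (1 / 2) ^ n < e"
      using that by (intro order_tendstoD(2)) auto
    then show ?thesis by (simp add: eventually_sequentially power_divide)
  qed
  have cauchy: "\<exists>n0. \<forall>m\<ge>n0. \<forall>n\<ge>n0. ?N (y m - y n) < e" if e: "e > 0" for e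
  proof -
    obtain n0 where n0: "\<And>n. n \<ge> n0 \<Longrightarrow> 2 * C / 2 ^ n < e" using small[OF e, of "2 * C"] by blast
    have ge: "?N (y m - y n) < e" if "n \<ge> n0" "m \<ge> n" for m n
    proof -
      have "?N (y m - y n) \<le> 2 * C / 2 ^ n - 2 * C / 2 ^ m" using far[of n "m - n"] that by simp
      also have "\<dots> \<le> 2 * C / 2 ^ n" using \<open>C > 0\<close> by simp
      finally show ?thesis using n0[OF that(1)] by simp
    qed
    have "?N (y m - y n) = ?N (y n - y m)" for m n
      using sup_op_norm_scaleR[OF yM[of m n], of "-1"] sup_op_norm_scaleR[OF yM[of n m], of "-1"]
      by simp
    then show ?thesis using ge by (metis nat_le_linear)
  qed
  have "\<forall>u. (\<forall>n. u n \<in> ?M) \<and> (\<forall>e>0. \<exists>n0. \<forall>m\<ge>n0. \<forall>n\<ge>n0. ?N (u m - u n) < e)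
      \<longrightarrow> (\<exists>x\<in>?M. (\<lambda>n. ?N (u n - x)) \<longlonglongrightarrow> 0)"
    using complete by (simp add: banach_under_def)
  then have "\<exists>x\<in>?M. (\<lambda>n. ?N (y n - x)) \<longlonglongrightarrow> 0"
    by (rule allE[where x = y]) (use cauchy M0_subset_M[OF y0] in simp)
  then obtain x0 where x0: "x0 \<in> ?M" "(\<lambda>n. ?N (y n - x0)) \<longlonglongrightarrow> 0"
    by blast
  have close: "\<exists>n0. \<forall>n\<ge>n0. ?N (y n - x0) < e" if "e > 0" for e
    using order_tendstoD(2)[OF x0(2) that] by (simp add: eventually_sequentially)
  have yx0: "y n - x0 \<in> ?M" for n
    by (intro subspace_diff[OF subspace_M_space] M0_subset_M y0 x0)
  \<comment> \<open>Completeness places the limit only in the larger space M; closedness brings it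
    into M_0.\<close>
  have "x0 \<in> M0_space T"
  proof (rule M0_space_closed[OF x0(1)])
    fix e :: real assume "e > 0"
    then obtain n where "?N (y n - x0) < e" using close by blast
    then have "?N (x0 - y n) \<le> e" using sup_op_norm_scaleR[OF yx0[of n], of "-1"] by simp
    then show "\<exists>z\<in>M0_space T. ?N (x0 - z) \<le> e" using y0 by blast
  qed
  moreover have "?N (x - x0) \<le> l"
  proof (rule field_le_epsilon)
    fix e :: real assume "e > 0"
    then have "e / 2 > 0" by simp
    obtain n1 n2 where n: "\<And>n. n \<ge> n1 \<Longrightarrow> ?N (y n - x0) < e / 2" "\<And>n. n \<ge> n2 \<Longrightarrow> C / 2 ^ n < e / 2"
      using close[OF \<open>e / 2 > 0\<close>] small[OF \<open>e / 2 > 0\<close>] by metis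
    obtain k where k: "n1 \<le> k" "n2 \<le> k" using max.cobounded1 max.cobounded2 by blast
    have "x - y k \<in> ?M" by (intro subspace_diff[OF subspace_M_space] x M0_subset_M y0)
    from sup_op_norm_add[OF this yx0[of k]]
    have "?N (x - x0) \<le> ?N (x - y k) + ?N (y k - x0)" by simp
    then show "?N (x - x0) \<le> l + e"
      using yx[of k] n(1)[of k] n(2)[of k] k by linarith
  qed
  ultimately show ?thesis using that by (simp add: l_def)
qed

theorem corollary1p2:
  fixes \<L> :: "('x::banach \<Rightarrow>\<^sub>L 'y::banach) set"
    and \<tau> :: "('x \<Rightarrow>\<^sub>L 'y) topology"
  assumes "separable_space (euclidean :: 'x topology)"
    and "reflexive_space TYPE('x)"
    and "topspace \<tau> = \<L>"
    and "Hausdorff_space \<tau>"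
    and "sigma_compact_space \<tau>"
    and "locally_compact_space \<tau>"
    and "\<And>x :: 'x. continuous_map \<tau> euclidean (\<lambda>L. blinfun_apply L x)"
    and "closure (M_space \<L>) = UNIV"
    and "banach_under (M_space \<L>) (M_norm \<L>)"
    and "\<exists>C. \<forall>x \<in> M_space \<L>. norm x \<le> C * M_norm \<L> x"
    and "assumption_A \<tau>"
    and "x \<in> M_space \<L>"
  shows "\<exists>x0. is_arg_min (\<lambda>z. M_norm \<L> (x - z)) (\<lambda>z. z \<in> M0_space \<tau>) x0
            \<and> M_dist \<L> x (M0_space \<tau>) = M_norm \<L> (x - x0)
            \<and> M_norm \<L> (x - x0) = limsup_escaping \<tau> x"
proof -
  have x: "x \<in> M_space (topspace \<tau>)" using assms by simp
  have lower: "limsup_escaping \<tau> x \<le> M_norm \<L> (x - z)" if "z \<in> M0_space \<tau>" for z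
    using limsup_escaping_le_diff[OF x that] assms(3) by simp
  obtain x0 where x0: "x0 \<in> M0_space \<tau>" "M_norm \<L> (x - x0) \<le> limsup_escaping \<tau> x"
    using M0_space_proximinal[OF assms(7,11) _ x] assms(3,9) by blast
  then have eq: "M_norm \<L> (x - x0) = limsup_escaping \<tau> x"
    using lower by (simp add: antisym)
  have "M_dist \<L> x (M0_space \<tau>) = M_norm \<L> (x - x0)"
    unfolding M_dist_def using x0(1) lower eq by (intro cInf_eq_minimum) (auto intro: rev_image_eqI)
  moreover have "is_arg_min (\<lambda>z. M_norm \<L> (x - z)) (\<lambda>z. z \<in> M0_space \<tau>) x0"
    using x0(1) lower eq by (auto simp: is_arg_min_linorder)
  ultimately show ?thesis using eq by blast
qed

end
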